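(* There exist a commutative operator algebra $A$ with an identity $1_A$ of norm $1$, a contractive projection $P : A \to A$ whose range is a subalgebra $B$ of $A$ containing $1_A$, and elements $a \in A$, $b \in B$, such that $P(ba) \neq b P(a)$.
   Context: All spaces are over $\mathbb{C}$. An operator algebra is an algebra of bounded operators on a Hilbert space $H$, i.e. a subalgebra of $B(H)$, with the norm inherited from $B(H)$. A contractive projection on $A$ is a linear map $P : A \to A$ with $P \circ P = P$ and $\|P\| \leq 1$. *)

theory Defs
  imports "HOL-Analysis.Analysis" "HOL-Library.Function_Algebras"
begin

text \<open>
  A complex Hilbert space is presented on a carrier \<open>H\<close>, a linear subspace of an ambient complex
  vector space, so that one can quantify existentially over Hilbert spaces inside a formula.
  The inner product is linear in the first argument.
\<close>

definition ip_norm :: "('v \<Rightarrow> 'v \<Rightarrow> complex) \<Rightarrow> 'v \<Rightarrow> real" where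
  "ip_norm ip x = sqrt (Re (ip x x))"

locale complex_hilbert_space = vector_space smul
  for smul :: "complex \<Rightarrow> 'v::ab_group_add \<Rightarrow> 'v" (infixr \<open>*s\<close> 75) +
  fixes H :: "'v set"
    and ip :: "'v \<Rightarrow> 'v \<Rightarrow> complex"
  assumes subspace_carrier: "subspace H"
    and ip_add_left: "\<lbrakk>x \<in> H; y \<in> H; z \<in> H\<rbrakk> \<Longrightarrow> ip (x + y) z = ip x z + ip y z"
    and ip_scale_left: "\<lbrakk>x \<in> H; y \<in> H\<rbrakk> \<Longrightarrow> ip (c *s x) y = c * ip x y"
    and ip_commute: "\<lbrakk>x \<in> H; y \<in> H\<rbrakk> \<Longrightarrow> ip y x = cnj (ip x y)"
    and ip_nonneg: "x \<in> H \<Longrightarrow> 0 \<le> Re (ip x x)"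
    and ip_definite: "\<lbrakk>x \<in> H; ip x x = 0\<rbrakk> \<Longrightarrow> x = 0"
    and complete_carrier:
      "\<lbrakk>\<And>n. X n \<in> H; \<forall>e>0. \<exists>N. \<forall>m\<ge>N. \<forall>n\<ge>N. ip_norm ip (X m - X n) < e\<rbrakk>
        \<Longrightarrow> \<exists>l\<in>H. (\<lambda>n. ip_norm ip (X n - l)) \<longlonglongrightarrow> 0"

text \<open>
  Operators on \<open>H\<close> are functions on the ambient space that vanish off \<open>H\<close>; this makes equality of
  functions coincide with equality of operators on \<open>H\<close>. Sums of operators are the pointwise sums
  of \<^theory>\<open>HOL-Library.Function_Algebras\<close>, products are compositions.
\<close>

definition bounded_ops ::
  "(complex \<Rightarrow> 'v::ab_group_add \<Rightarrow> 'v) \<Rightarrow> 'v set \<Rightarrow> ('v \<Rightarrow> 'v \<Rightarrow> complex) \<Rightarrow> ('v \<Rightarrow> 'v) set" where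
  "bounded_ops smul H ip = {T.
      (\<forall>x\<in>H. T x \<in> H) \<and>
      (\<forall>x\<in>H. \<forall>y\<in>H. T (x + y) = T x + T y) \<and>
      (\<forall>c. \<forall>x\<in>H. T (smul c x) = smul c (T x)) \<and>
      (\<exists>K. \<forall>x\<in>H. ip_norm ip (T x) \<le> K * ip_norm ip x) \<and>
      (\<forall>x. x \<notin> H \<longrightarrow> T x = 0)}"

definition op_norm :: "'v set \<Rightarrow> ('v \<Rightarrow> 'v \<Rightarrow> complex) \<Rightarrow> ('v \<Rightarrow> 'v) \<Rightarrow> real" where
  "op_norm H ip T = (SUP x\<in>{x \<in> H. ip_norm ip x \<le> 1}. ip_norm ip (T x))"

definition op_smult :: "(complex \<Rightarrow> 'v \<Rightarrow> 'v) \<Rightarrow> complex \<Rightarrow> ('v \<Rightarrow> 'v) \<Rightarrow> ('v \<Rightarrow> 'v)" where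
  "op_smult smul c T = (\<lambda>x. smul c (T x))"

lemma module_op_smult:
  assumes "vector_space smul"
  shows "module (op_smult smul)"
proof -
  interpret vector_space smul by fact
  show ?thesis
    by standard (auto simp: op_smult_def fun_eq_iff scale_right_distrib scale_left_distrib)
qed

definition operator_algebra ::
  "(complex \<Rightarrow> 'v::ab_group_add \<Rightarrow> 'v) \<Rightarrow> 'v set \<Rightarrow> ('v \<Rightarrow> 'v \<Rightarrow> complex) \<Rightarrow> ('v \<Rightarrow> 'v) set \<Rightarrow> bool" where
  "operator_algebra smul H ip A \<longleftrightarrow>
      A \<subseteq> bounded_ops smul H ip \<and>
      module.subspace (op_smult smul) A \<and>
      (\<forall>S\<in>A. \<forall>T\<in>A. S \<circ> T \<in> A)"

text \<open>The identity of \<open>A\<close> is not required to be the identity operator of \<open>H\<close>.\<close>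

definition is_identity_of :: "('v \<Rightarrow> 'v) \<Rightarrow> ('v \<Rightarrow> 'v) set \<Rightarrow> bool" where
  "is_identity_of e A \<longleftrightarrow> e \<in> A \<and> (\<forall>T\<in>A. e \<circ> T = T \<and> T \<circ> e = T)"

definition contractive_projection ::
  "(complex \<Rightarrow> 'v::ab_group_add \<Rightarrow> 'v) \<Rightarrow> 'v set \<Rightarrow> ('v \<Rightarrow> 'v \<Rightarrow> complex) \<Rightarrow> ('v \<Rightarrow> 'v) set
    \<Rightarrow> (('v \<Rightarrow> 'v) \<Rightarrow> ('v \<Rightarrow> 'v)) \<Rightarrow> bool" where
  "contractive_projection smul H ip A P \<longleftrightarrow>
      (\<forall>T\<in>A. P T \<in> A) \<and>
      (\<forall>S\<in>A. \<forall>T\<in>A. P (S + T) = P S + P T) \<and>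
      (\<forall>c. \<forall>T\<in>A. P (op_smult smul c T) = op_smult smul c (P T)) \<and>
      (\<forall>T\<in>A. P (P T) = P T) \<and>
      (\<forall>T\<in>A. op_norm H ip (P T) \<le> op_norm H ip T)"

end

theory Submission
  imports Defs
begin

text \<open>
  Write \<open>U(X)\<close> for the algebra of block matrices with a scalar \<open>\<alpha>\<close> on the diagonal and an element
  \<open>x\<close> of an operator space \<open>X\<close> in the upper right corner. Products of corner elements vanish, and
  for \<open>M > 0\<close> the norm is at most \<open>M\<close> iff \<open>\<bar>\<alpha>\<bar> \<le> M\<close> and \<open>\<parallel>x\<parallel> M \<le> M\<^sup>2 - \<bar>\<alpha>\<bar>\<^sup>2\<close>. Take for \<open>X\<close> the span of the
  identity and of the matrix unit \<open>E\<close> in the 2 by 2 matrices. The numerical range of \<open>E\<close> is a disc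
  of radius 1/2, so \<open>\<parallel>\<beta> + \<gamma>E\<parallel> \<ge> \<bar>\<beta>\<bar> + \<bar>\<gamma>\<bar>/2\<close>. This gain of \<open>\<bar>\<gamma>\<bar>/2\<close> pays for moving \<open>\<gamma>/4\<close> from the
  corner to the diagonal: the map \<open>(\<alpha>, \<beta>, \<gamma>) \<mapsto> (\<alpha> + \<gamma>/4, \<beta>, 0)\<close> is contractive. It sends the
  corner element \<open>E\<close> to a multiple of the identity, although every corner element annihilates \<open>E\<close>.
\<close>

section \<open>Finite-dimensional coordinate spaces\<close>

definition coord_smul :: "complex \<Rightarrow> (nat \<Rightarrow> complex) \<Rightarrow> (nat \<Rightarrow> complex)" where
  "coord_smul c f = (\<lambda>i. c * f i)"

text \<open>The space \<open>C^n\<close> is realised inside the sequences because the theorem fixes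
  the ambient type \<open>nat \<Rightarrow> complex\<close>.\<close>

definition coord_space :: "nat \<Rightarrow> (nat \<Rightarrow> complex) set" where
  "coord_space n = {f. \<forall>i\<ge>n. f i = 0}"

definition coord_ip :: "nat \<Rightarrow> (nat \<Rightarrow> complex) \<Rightarrow> (nat \<Rightarrow> complex) \<Rightarrow> complex" where
  "coord_ip n f g = (\<Sum>i<n. f i * cnj (g i))"

lemma vector_space_coord_smul: "vector_space coord_smul"
  by standard (auto simp: coord_smul_def fun_eq_iff algebra_simps)

lemma coord_ip_self: "coord_ip n f f = of_real (\<Sum>i<n. (cmod (f i))\<^sup>2)"
  unfolding coord_ip_def of_real_sum complex_norm_square ..

lemma ip_norm_coord_ip: "ip_norm (coord_ip n) f = sqrt (\<Sum>i<n. (cmod (f i))\<^sup>2)"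
  unfolding ip_norm_def coord_ip_self by simp

lemma ip_norm_coord_ip_L2_set: "ip_norm (coord_ip n) f = L2_set (\<lambda>i. cmod (f i)) {..<n}"
  by (simp add: ip_norm_coord_ip L2_set_def)

lemma ip_norm_coord_ip_nonneg: "0 \<le> ip_norm (coord_ip n) f"
  by (simp add: ip_norm_coord_ip sum_nonneg)

lemma cmod_le_ip_norm_coord_ip: "i < n \<Longrightarrow> cmod (f i) \<le> ip_norm (coord_ip n) f"
  unfolding ip_norm_coord_ip_L2_set
  by (rule member_le_L2_set) auto

lemma ip_norm_coord_ip_le_sum: "ip_norm (coord_ip n) f \<le> (\<Sum>i<n. cmod (f i))"
  unfolding ip_norm_coord_ip_L2_set
  by (rule L2_set_le_sum) auto

lemma ip_norm_coord_smul:
  "ip_norm (coord_ip n) (coord_smul c f) = cmod c * ip_norm (coord_ip n) f"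
  by (simp add: ip_norm_coord_ip coord_smul_def norm_mult power_mult_distrib
      sum_distrib_left[symmetric] real_sqrt_mult)

lemma complex_hilbert_space_coord:
  "complex_hilbert_space coord_smul (coord_space n) (coord_ip n)"
proof -
  interpret vector_space coord_smul by (rule vector_space_coord_smul)
  show ?thesis
  proof
    show "subspace (coord_space n)"
      by (auto simp: subspace_def coord_space_def coord_smul_def)
  next
    fix f g h :: "nat \<Rightarrow> complex"
    show "coord_ip n (f + g) h = coord_ip n f h + coord_ip n g h"
      by (simp add: coord_ip_def distrib_right sum.distrib)
  next
    fix f g :: "nat \<Rightarrow> complex" and c
    show "coord_ip n (coord_smul c f) g = c * coord_ip n f g"
      by (simp add: coord_ip_def coord_smul_def sum_distrib_left mult.assoc)
  next
    fix f g :: "nat \<Rightarrow> complex"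
    show "coord_ip n g f = cnj (coord_ip n f g)"
      by (simp add: coord_ip_def mult.commute)
  next
    fix f :: "nat \<Rightarrow> complex"
    show "0 \<le> Re (coord_ip n f f)"
      by (simp add: coord_ip_self sum_nonneg)
  next
    fix f :: "nat \<Rightarrow> complex"
    assume f: "f \<in> coord_space n" "coord_ip n f f = 0"
    then have "(\<Sum>i<n. (cmod (f i))\<^sup>2) = 0"
      by (simp only: coord_ip_self of_real_eq_0_iff)
    then have "f i = 0" if "i < n" for i
      using that by (simp add: sum_nonneg_eq_0_iff)
    with f(1) show "f = 0"
      by (auto simp: coord_space_def fun_eq_iff) (meson not_le)
  next
    fix X :: "nat \<Rightarrow> nat \<Rightarrow> complex"
    assume X: "\<And>m. X m \<in> coord_space n"
      and C: "\<forall>e>0. \<exists>N. \<forall>m\<ge>N. \<forall>k\<ge>N. ip_norm (coord_ip n) (X m - X k) < e"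
    have "Cauchy (\<lambda>m. X m i)" if "i < n" for i
    proof (rule metric_CauchyI)
      fix e :: real assume "e > 0"
      with C obtain N where
        N: "ip_norm (coord_ip n) (X m - X k) < e" if "m \<ge> N" "k \<ge> N" for m k by meson
      have "dist (X m i) (X k i) < e" if "m \<ge> N" "k \<ge> N" for m k
        using cmod_le_ip_norm_coord_ip[OF \<open>i < n\<close>, of "X m - X k"] N[OF that]
        by (simp add: dist_norm)
      then show "\<exists>N. \<forall>m\<ge>N. \<forall>k\<ge>N. dist (X m i) (X k i) < e" by blast
    qed
    then have "\<forall>i. \<exists>l. i < n \<longrightarrow> (\<lambda>m. X m i) \<longlonglongrightarrow> l"
      by (meson Cauchy_convergent convergent_def)
    then obtain L where L: "\<And>i. i < n \<Longrightarrow> (\<lambda>m. X m i) \<longlonglongrightarrow> L i" by metis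
    \<comment> \<open>Only the coordinates below \<open>n\<close> have limits; the default 0 keeps
      \<open>l\<close> in the carrier.\<close>
    define l where "l = (\<lambda>i. if i < n then L i else 0)"
    have "(\<lambda>m. ip_norm (coord_ip n) (X m - l)) \<longlonglongrightarrow> sqrt (\<Sum>i<n. (cmod (L i - l i))\<^sup>2)"
      unfolding ip_norm_coord_ip minus_apply
      by (intro tendsto_intros L) auto
    moreover have "(\<Sum>i<n. (cmod (L i - l i))\<^sup>2) = 0"
      by (rule sum.neutral) (auto simp: l_def)
    ultimately show "\<exists>l\<in>coord_space n. (\<lambda>m. ip_norm (coord_ip n) (X m - l)) \<longlonglongrightarrow> 0"
      by (intro bexI[of _ l]) (auto simp: l_def coord_space_def)
  qed
qed

section \<open>The operator norm on coordinate spaces\<close>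

lemma bdd_above_op_norm:
  assumes "T \<in> bounded_ops coord_smul (coord_space n) (coord_ip n)"
  shows "bdd_above ((\<lambda>f. ip_norm (coord_ip n) (T f)) `
    {f \<in> coord_space n. ip_norm (coord_ip n) f \<le> 1})"
proof -
  obtain K where K: "\<And>f. f \<in> coord_space n \<Longrightarrow>
      ip_norm (coord_ip n) (T f) \<le> K * ip_norm (coord_ip n) f"
    using assms unfolding bounded_ops_def by blast
  \<comment> \<open>The absolute value is taken because the definition of \<open>bounded_ops\<close>
    does not make \<open>K\<close> nonnegative.\<close>
  have "ip_norm (coord_ip n) (T f) \<le> \<bar>K\<bar>"
    if f: "f \<in> coord_space n" "ip_norm (coord_ip n) f \<le> 1" for f
  proof -
    have "ip_norm (coord_ip n) (T f) \<le> \<bar>K\<bar> * ip_norm (coord_ip n) f"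
      using K[OF f(1)] ip_norm_coord_ip_nonneg[of n f]
      by (meson abs_ge_self mult_right_mono order_trans)
    also have "\<dots> \<le> \<bar>K\<bar>"
      using f(2) by (simp add: mult_left_le)
    finally show ?thesis .
  qed
  then show ?thesis by (auto intro!: bdd_aboveI)
qed

lemma ip_norm_le_op_norm:
  assumes T: "T \<in> bounded_ops coord_smul (coord_space n) (coord_ip n)"
    and f: "f \<in> coord_space n"
  shows "ip_norm (coord_ip n) (T f)
    \<le> op_norm (coord_space n) (coord_ip n) T * ip_norm (coord_ip n) f"
proof (cases "ip_norm (coord_ip n) f = 0")
  case True
  \<comment> \<open>A vector of norm 0 cannot be normalised; boundedness makes its image have norm 0
    as well.\<close>
  obtain K where "ip_norm (coord_ip n) (T f) \<le> K * ip_norm (coord_ip n) f"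
    using T f by (auto simp: bounded_ops_def)
  with True show ?thesis by simp
next
  case False
  define r where "r = ip_norm (coord_ip n) f"
  have r: "r > 0"
    using False ip_norm_coord_ip_nonneg[of n f] by (simp add: r_def)
  define g where "g = coord_smul (of_real (1 / r)) f"
  have g: "g \<in> coord_space n"
    using f by (simp add: g_def coord_space_def coord_smul_def)
  have "ip_norm (coord_ip n) g = 1"
    using r by (simp add: g_def ip_norm_coord_smul norm_divide flip: r_def)
  then have "ip_norm (coord_ip n) (T g) \<le> op_norm (coord_space n) (coord_ip n) T"
    unfolding op_norm_def using g by (intro cSUP_upper bdd_above_op_norm[OF T]) auto
  moreover have "T g = coord_smul (of_real (1 / r)) (T f)"
    using T f by (simp add: g_def bounded_ops_def)
  ultimately show ?thesis
    using r by (simp add: ip_norm_coord_smul norm_divide field_simps flip: r_def)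
qed

lemma op_norm_le:
  assumes "M \<ge> 0"
    and "\<And>f. f \<in> coord_space n \<Longrightarrow> ip_norm (coord_ip n) (T f) \<le> M * ip_norm (coord_ip n) f"
  shows "op_norm (coord_space n) (coord_ip n) T \<le> M"
  unfolding op_norm_def
proof (rule cSUP_least)
  have "(\<lambda>i. 0) \<in> {f \<in> coord_space n. ip_norm (coord_ip n) f \<le> 1}"
    by (simp add: coord_space_def ip_norm_coord_ip)
  then show "{f \<in> coord_space n. ip_norm (coord_ip n) f \<le> 1} \<noteq> {}" by blast
next
  fix f assume "f \<in> {f \<in> coord_space n. ip_norm (coord_ip n) f \<le> 1}"
  then show "ip_norm (coord_ip n) (T f) \<le> M"
    using assms(2)[of f] mult_left_le[OF _ assms(1), of "ip_norm (coord_ip n) f"] by auto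
qed

section \<open>The norm of a 2 by 2 upper triangular Toeplitz matrix\<close>

text \<open>By the triangle inequality it suffices that a real quadratic form in
  \<open>\<bar>u\<bar>\<close> and \<open>\<bar>v\<bar>\<close> is nonnegative. With
  \<open>D = M^2 - \<bar>\<alpha>\<bar>^2\<close>, its discriminant condition \<open>D (D -
  \<bar>\<beta>\<bar>^2) \<ge> \<bar>\<alpha>\<bar>^2 \<bar>\<beta>\<bar>^2\<close> simplifies to
  \<open>\<bar>\<beta>\<bar> M \<le> D\<close>.\<close>

lemma toeplitz_norm_bound:
  assumes a: "cmod \<alpha> \<le> M" and b: "cmod \<beta> * M \<le> M\<^sup>2 - (cmod \<alpha>)\<^sup>2" and M: "cmod \<beta> \<le> M"
  shows "(cmod (\<alpha> * u + \<beta> * v))\<^sup>2 + (cmod (\<alpha> * v))\<^sup>2 \<le> M\<^sup>2 * ((cmod u)\<^sup>2 + (cmod v)\<^sup>2)"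
proof -
  define A B U V where "A = cmod \<alpha>" and "B = cmod \<beta>" and "U = cmod u" and "V = cmod v"
  note defs = A_def B_def U_def V_def
  define D where "D = M\<^sup>2 - A\<^sup>2"
  have nn: "A \<ge> 0" "B \<ge> 0" "U \<ge> 0" "V \<ge> 0" "M \<ge> 0"
    using a by (auto simp: defs intro: order_trans[OF norm_ge_zero])
  have D: "D \<ge> 0" "B * M \<le> D"
    using b a by (auto simp: D_def defs power_mono)
  have form: "0 \<le> D * U\<^sup>2 - 2 * A * B * U * V + (D - B\<^sup>2) * V\<^sup>2"
  proof (cases "D = 0")
    case True
    \<comment> \<open>Here \<open>B * M \<le> 0\<close>. If \<open>M = 0\<close> this says nothing
      about \<open>B\<close>, and the hypothesis \<open>cmod \<beta> \<le> M\<close> takes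
      over.\<close>
    then have "B = 0"
      using D(2) nn M by (auto simp: mult_le_0_iff defs)
    with True show ?thesis by simp
  next
    case False
    have "(B * M)\<^sup>2 \<le> D\<^sup>2" using D nn by (intro power_mono) auto
    \<comment> \<open>Completing the square in the form multiplied by \<open>D\<close>.\<close>
    then have "0 \<le> (D * U - A * B * V)\<^sup>2 + (D\<^sup>2 - (B * M)\<^sup>2) * V\<^sup>2" by simp
    also have "\<dots> = D * (D * U\<^sup>2 - 2 * A * B * U * V + (D - B\<^sup>2) * V\<^sup>2)"
      unfolding D_def by (simp add: power2_eq_square algebra_simps)
    finally show ?thesis
      using False D(1) by (simp add: zero_le_mult_iff)
  qed
  have "cmod (\<alpha> * u + \<beta> * v) \<le> A * U + B * V"
    unfolding defs by (rule norm_triangle_le) (simp add: norm_mult)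
  then have "(cmod (\<alpha> * u + \<beta> * v))\<^sup>2 \<le> (A * U + B * V)\<^sup>2"
    by (rule power_mono) simp
  moreover have "(cmod (\<alpha> * v))\<^sup>2 = A\<^sup>2 * V\<^sup>2"
    by (simp add: defs norm_mult power_mult_distrib)
  moreover have "M\<^sup>2 * (U\<^sup>2 + V\<^sup>2) - ((A * U + B * V)\<^sup>2 + A\<^sup>2 * V\<^sup>2)
      = D * U\<^sup>2 - 2 * A * B * U * V + (D - B\<^sup>2) * V\<^sup>2"
    unfolding D_def by (simp add: power2_eq_square algebra_simps)
  ultimately show ?thesis
    using form unfolding U_def[symmetric] V_def[symmetric] by linarith
qed

text \<open>Converse of \<open>toeplitz_norm_bound\<close>. The vectors \<open>(1, 0)\<close> and
  \<open>(0, 1)\<close> bound the two moduli. The last bound needs a vector at which the argument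
  there is sharp: aligned phases make the triangle inequality an equality, and moduli in the ratio
  \<open>A B : D\<close> make the completed square vanish.\<close>

lemma toeplitz_entry_bounds:
  assumes M: "M \<ge> 0"
    and bound: "\<And>u v. (cmod (\<alpha> * u + \<beta> * v))\<^sup>2 + (cmod (\<alpha> * v))\<^sup>2
      \<le> M\<^sup>2 * ((cmod u)\<^sup>2 + (cmod v)\<^sup>2)"
  shows "cmod \<alpha> \<le> M" and "cmod \<beta> \<le> M" and "cmod \<beta> * M \<le> M\<^sup>2 - (cmod \<alpha>)\<^sup>2"
proof -
  define A B where "A = cmod \<alpha>" and "B = cmod \<beta>"
  define D where "D = M\<^sup>2 - A\<^sup>2"
  have nn: "A \<ge> 0" "B \<ge> 0" by (simp_all add: A_def B_def)
  have "A\<^sup>2 \<le> M\<^sup>2" using bound[of 1 0] by (simp add: A_def)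
  then show "cmod \<alpha> \<le> M" using M unfolding A_def by (rule power2_le_imp_le)
  have BD: "B\<^sup>2 \<le> D" using bound[of 0 1] by (simp add: A_def B_def D_def)
  then have "B\<^sup>2 \<le> M\<^sup>2" using zero_le_power2[of A] unfolding D_def by linarith
  then show "cmod \<beta> \<le> M" using M unfolding B_def by (rule power2_le_imp_le)
  have D0: "D \<ge> 0" using \<open>A\<^sup>2 \<le> M\<^sup>2\<close> by (simp add: D_def)
  have "B * M \<le> D"
  proof (cases "D = 0")
    case True
    with BD show ?thesis by simp
  next
    case False
    \<comment> \<open>the phases are chosen such that \<open>\<alpha> * u\<close> is a positive multiple of \<open>\<beta> * v\<close>\<close>
    define u v where "u = cnj \<alpha> * \<beta>" and "v = complex_of_real D"
    have au: "\<alpha> * u = of_real (A\<^sup>2) * \<beta>"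
      unfolding u_def A_def by (simp only: complex_norm_square mult.assoc)
    have "\<alpha> * u + \<beta> * v = of_real (A\<^sup>2 + D) * \<beta>"
      unfolding au v_def by (simp add: algebra_simps)
    then have "cmod (\<alpha> * u + \<beta> * v) = M\<^sup>2 * B"
      by (simp only: norm_mult norm_of_real B_def) (simp add: D_def)
    moreover have "cmod (\<alpha> * v) = A * D" "cmod u = A * B" "cmod v = D"
      using D0 by (simp_all add: u_def v_def norm_mult A_def B_def)
    ultimately have "(M\<^sup>2 * B)\<^sup>2 + (A * D)\<^sup>2 \<le> M\<^sup>2 * ((A * B)\<^sup>2 + D\<^sup>2)"
      using bound[of u v] by simp
    moreover have "M\<^sup>2 * ((A * B)\<^sup>2 + D\<^sup>2) - ((M\<^sup>2 * B)\<^sup>2 + (A * D)\<^sup>2) = D * (D\<^sup>2 - (B * M)\<^sup>2)"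
      unfolding D_def by (simp add: power2_eq_square algebra_simps)
    ultimately have "0 \<le> D * (D\<^sup>2 - (B * M)\<^sup>2)" by linarith
    then have "(B * M)\<^sup>2 \<le> D\<^sup>2" using False D0 by (simp add: zero_le_mult_iff)
    then show ?thesis using D0 by (rule power2_le_imp_le)
  qed
  then show "cmod \<beta> * M \<le> M\<^sup>2 - (cmod \<alpha>)\<^sup>2" by (simp add: A_def B_def D_def)
qed

section \<open>The algebra\<close>

text \<open>Coordinates 0, 1 form the first block and 2, 3 the second; the block rows are
  \<open>(\<alpha> I, \<beta> I + \<gamma> E)\<close> and \<open>(0, \<alpha> I)\<close>. The value
  0 off the carrier is what \<open>bounded_ops\<close> demands.\<close>

definition tri_op :: "complex \<Rightarrow> complex \<Rightarrow> complex \<Rightarrow> (nat \<Rightarrow> complex) \<Rightarrow> (nat \<Rightarrow> complex)" where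
  "tri_op \<alpha> \<beta> \<gamma> f = (if f \<in> coord_space 4 then
     (\<lambda>i. if i = 0 then \<alpha> * f 0 + \<beta> * f 2 + \<gamma> * f 3
          else if i = 1 then \<alpha> * f 1 + \<beta> * f 3
          else \<alpha> * f i) else 0)"

definition tri_alg :: "((nat \<Rightarrow> complex) \<Rightarrow> (nat \<Rightarrow> complex)) set" where
  "tri_alg = {tri_op \<alpha> \<beta> \<gamma> |\<alpha> \<beta> \<gamma>. True}"

definition tri_unit :: "nat \<Rightarrow> nat \<Rightarrow> complex" where
  "tri_unit j = (\<lambda>i. if i = j then 1 else 0)"

text \<open>The arguments of \<^const>\<open>tri_op\<close> are read off from the first row of the matrix of \<open>T\<close>.\<close>

definition tri_proj :: "((nat \<Rightarrow> complex) \<Rightarrow> (nat \<Rightarrow> complex)) \<Rightarrow> (nat \<Rightarrow> complex) \<Rightarrow> (nat \<Rightarrow> complex)"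
  where "tri_proj T = tri_op (T (tri_unit 0) 0 + T (tri_unit 3) 0 / 4) (T (tri_unit 2) 0) 0"

lemma tri_unit_in_coord_space: "j < n \<Longrightarrow> tri_unit j \<in> coord_space n"
  by (auto simp: tri_unit_def coord_space_def)

lemma tri_op_first_row:
  "tri_op \<alpha> \<beta> \<gamma> (tri_unit 0) 0 = \<alpha>"
  "tri_op \<alpha> \<beta> \<gamma> (tri_unit 2) 0 = \<beta>"
  "tri_op \<alpha> \<beta> \<gamma> (tri_unit 3) 0 = \<gamma>"
  by (simp_all add: tri_op_def tri_unit_in_coord_space) (simp_all add: tri_unit_def)

lemma tri_op_eq_iff: "tri_op \<alpha> \<beta> \<gamma> = tri_op \<alpha>' \<beta>' \<gamma>' \<longleftrightarrow> \<alpha> = \<alpha>' \<and> \<beta> = \<beta>' \<and> \<gamma> = \<gamma>'"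
  by (metis tri_op_first_row)

lemma tri_proj_tri_op: "tri_proj (tri_op \<alpha> \<beta> \<gamma>) = tri_op (\<alpha> + \<gamma> / 4) \<beta> 0"
  by (simp add: tri_proj_def tri_op_first_row)

lemma tri_op_in_coord_space: "tri_op \<alpha> \<beta> \<gamma> f \<in> coord_space 4"
  by (auto simp: tri_op_def coord_space_def)

lemma tri_op_add: "tri_op \<alpha> \<beta> \<gamma> + tri_op \<alpha>' \<beta>' \<gamma>' = tri_op (\<alpha> + \<alpha>') (\<beta> + \<beta>') (\<gamma> + \<gamma>')"
  by (auto simp: tri_op_def fun_eq_iff algebra_simps)

lemma tri_op_smult: "op_smult coord_smul c (tri_op \<alpha> \<beta> \<gamma>) = tri_op (c * \<alpha>) (c * \<beta>) (c * \<gamma>)"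
  by (auto simp: tri_op_def op_smult_def coord_smul_def fun_eq_iff algebra_simps)

lemma tri_op_zero: "tri_op 0 0 0 = 0"
  by (auto simp: tri_op_def fun_eq_iff)

text \<open>Two corner blocks multiply to zero, so only scalar times corner survives off the
  diagonal. The formula is symmetric in the two factors, which gives commutativity.\<close>

lemma tri_op_comp:
  "tri_op \<alpha> \<beta> \<gamma> \<circ> tri_op \<alpha>' \<beta>' \<gamma>'
    = tri_op (\<alpha> * \<alpha>') (\<alpha> * \<beta>' + \<alpha>' * \<beta>) (\<alpha> * \<gamma>' + \<alpha>' * \<gamma>)"
proof
  fix f
  show "(tri_op \<alpha> \<beta> \<gamma> \<circ> tri_op \<alpha>' \<beta>' \<gamma>') f
    = tri_op (\<alpha> * \<alpha>') (\<alpha> * \<beta>' + \<alpha>' * \<beta>) (\<alpha> * \<gamma>' + \<alpha>' * \<gamma>) f"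
    using tri_op_in_coord_space[of \<alpha>' \<beta>' \<gamma>' f]
    by (auto simp: tri_op_def fun_eq_iff algebra_simps)
qed

lemma tri_op_bounded: "tri_op \<alpha> \<beta> \<gamma> \<in> bounded_ops coord_smul (coord_space 4) (coord_ip 4)"
proof -
  \<comment> \<open>The constant adds the moduli of the seven matrix positions: four hold \<alpha>,
    two \<beta> and one \<gamma>.\<close>
  have "ip_norm (coord_ip 4) (tri_op \<alpha> \<beta> \<gamma> f)
      \<le> (4 * cmod \<alpha> + 2 * cmod \<beta> + cmod \<gamma>) * ip_norm (coord_ip 4) f"
    if f: "f \<in> coord_space 4" for f
  proof -
    let ?N = "ip_norm (coord_ip 4) f"
    have le: "cmod (c * f i) \<le> cmod c * ?N" if "i < 4" for c i
      using cmod_le_ip_norm_coord_ip[OF that, of f] by (simp add: norm_mult mult_left_mono)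
    have "ip_norm (coord_ip 4) (tri_op \<alpha> \<beta> \<gamma> f) \<le> (\<Sum>i<4. cmod (tri_op \<alpha> \<beta> \<gamma> f i))"
      by (rule ip_norm_coord_ip_le_sum)
    also have "\<dots> = cmod (\<alpha> * f 0 + \<beta> * f 2 + \<gamma> * f 3) + cmod (\<alpha> * f 1 + \<beta> * f 3)
        + cmod (\<alpha> * f 2) + cmod (\<alpha> * f 3)"
      using f by (simp add: tri_op_def eval_nat_numeral)
    also have "\<dots> \<le> (cmod (\<alpha> * f 0) + cmod (\<beta> * f 2) + cmod (\<gamma> * f 3))
        + (cmod (\<alpha> * f 1) + cmod (\<beta> * f 3)) + cmod (\<alpha> * f 2) + cmod (\<alpha> * f 3)"
      by (intro add_mono order.refl norm_triangle_ineq order_trans[OF norm_triangle_ineq])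
    also have "\<dots> \<le> (4 * cmod \<alpha> + 2 * cmod \<beta> + cmod \<gamma>) * ?N"
      using le[of 0 \<alpha>] le[of 1 \<alpha>] le[of 2 \<alpha>] le[of 3 \<alpha>] le[of 2 \<beta>] le[of 3 \<beta>] le[of 3 \<gamma>]
      by (simp add: distrib_right)
    finally show ?thesis .
  qed
  moreover have "tri_op \<alpha> \<beta> \<gamma> (f + g) = tri_op \<alpha> \<beta> \<gamma> f + tri_op \<alpha> \<beta> \<gamma> g"
    if fg: "f \<in> coord_space 4" "g \<in> coord_space 4" for f g
  proof -
    have "f + g \<in> coord_space 4" using fg by (simp add: coord_space_def)
    with fg show ?thesis by (simp add: tri_op_def fun_eq_iff algebra_simps)
  qed
  moreover have "tri_op \<alpha> \<beta> \<gamma> (coord_smul c f) = coord_smul c (tri_op \<alpha> \<beta> \<gamma> f)"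
    if f: "f \<in> coord_space 4" for c f
  proof -
    have "coord_smul c f \<in> coord_space 4" using f by (simp add: coord_space_def coord_smul_def)
    with f show ?thesis by (simp add: tri_op_def coord_smul_def fun_eq_iff algebra_simps)
  qed
  moreover have "tri_op \<alpha> \<beta> \<gamma> f = 0" if "f \<notin> coord_space 4" for f
    using that by (simp add: tri_op_def)
  ultimately show ?thesis
    unfolding bounded_ops_def using tri_op_in_coord_space by blast
qed

section \<open>Norm estimates and contractivity of the projection\<close>

lemma op_norm_tri_op_nonneg: "0 \<le> op_norm (coord_space 4) (coord_ip 4) (tri_op \<alpha> \<beta> \<gamma>)"
proof -
  have "ip_norm (coord_ip 4) (tri_op \<alpha> \<beta> \<gamma> (tri_unit 0))
      \<le> op_norm (coord_space 4) (coord_ip 4) (tri_op \<alpha> \<beta> \<gamma>) * ip_norm (coord_ip 4) (tri_unit 0)"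
    by (intro ip_norm_le_op_norm tri_op_bounded tri_unit_in_coord_space) simp
  moreover have "ip_norm (coord_ip 4) (tri_unit 0) = 1"
    by (simp add: ip_norm_coord_ip tri_unit_def eval_nat_numeral)
  ultimately show ?thesis
    using ip_norm_coord_ip_nonneg[of 4 "tri_op \<alpha> \<beta> \<gamma> (tri_unit 0)"] by simp
qed

text \<open>The norm inequality in free coordinates, ready for the substitution of test
  vectors.\<close>

lemma tri_op_square_bound:
  fixes \<alpha> \<beta> \<gamma> x0 x1 x2 x3 :: complex
  defines "M \<equiv> op_norm (coord_space 4) (coord_ip 4) (tri_op \<alpha> \<beta> \<gamma>)"
  shows "(cmod (\<alpha> * x0 + \<beta> * x2 + \<gamma> * x3))\<^sup>2 + (cmod (\<alpha> * x1 + \<beta> * x3))\<^sup>2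
      + (cmod (\<alpha> * x2))\<^sup>2 + (cmod (\<alpha> * x3))\<^sup>2
    \<le> M\<^sup>2 * ((cmod x0)\<^sup>2 + (cmod x1)\<^sup>2 + (cmod x2)\<^sup>2 + (cmod x3)\<^sup>2)"
proof -
  define f where "f = (\<lambda>i::nat. if i = 0 then x0 else if i = 1 then x1 else if i = 2 then x2
    else if i = 3 then x3 else 0)"
  have f: "f \<in> coord_space 4" by (auto simp: f_def coord_space_def)
  have "ip_norm (coord_ip 4) (tri_op \<alpha> \<beta> \<gamma> f) \<le> M * ip_norm (coord_ip 4) f"
    unfolding M_def by (intro ip_norm_le_op_norm tri_op_bounded f)
  then have "(ip_norm (coord_ip 4) (tri_op \<alpha> \<beta> \<gamma> f))\<^sup>2 \<le> (M * ip_norm (coord_ip 4) f)\<^sup>2"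
    by (rule power_mono) (rule ip_norm_coord_ip_nonneg)
  then have "(\<Sum>i<4. (cmod (tri_op \<alpha> \<beta> \<gamma> f i))\<^sup>2) \<le> M\<^sup>2 * (\<Sum>i<4. (cmod (f i))\<^sup>2)"
    by (simp add: ip_norm_coord_ip power_mult_distrib sum_nonneg)
  then show ?thesis
    using f by (simp add: tri_op_def eval_nat_numeral) (simp add: f_def)
qed

text \<open>Supplies the phase of the test vector \<open>(1, \<omega>)\<close> that realises the
  gain from the numerical range of \<open>E\<close>.\<close>

lemma exists_unimodular_aligned: "\<exists>\<omega>. cmod \<omega> = 1 \<and> cmod (\<beta> + \<gamma> * \<omega>) = cmod \<beta> + cmod \<gamma>"
proof -
  \<comment> \<open>The phase of \<open>z\<close>, set to 1 at 0 so that it is always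
    unimodular.\<close>
  define r where "r = (\<lambda>z::complex. if z = 0 then 1 else sgn z)"
  have r: "cmod (r z) = 1" "of_real (cmod z) * r z = z" for z
    by (auto simp: r_def norm_sgn) (simp add: sgn_eq)
  define \<omega> where "\<omega> = r \<beta> * cnj (r \<gamma>)"
  have rr: "r \<gamma> * cnj (r \<gamma>) = 1"
    using complex_norm_square[of "r \<gamma>"] by (simp add: r(1))
  have "\<beta> + \<gamma> * \<omega> = of_real (cmod \<beta>) * r \<beta> + of_real (cmod \<gamma>) * r \<beta> * (r \<gamma> * cnj (r \<gamma>))"
  proof -
    have "\<gamma> * \<omega> = (of_real (cmod \<gamma>) * r \<gamma>) * \<omega>" by (simp only: r(2))
    also have "\<dots> = of_real (cmod \<gamma>) * r \<beta> * (r \<gamma> * cnj (r \<gamma>))"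
      unfolding \<omega>_def by (simp only: mult_ac)
    finally show ?thesis by (simp only: r(2))
  qed
  also have "\<dots> = of_real (cmod \<beta> + cmod \<gamma>) * r \<beta>"
    unfolding rr by (simp add: algebra_simps)
  finally have "cmod (\<beta> + \<gamma> * \<omega>) = cmod \<beta> + cmod \<gamma>"
    by (simp add: norm_mult r(1) del: of_real_add)
  then show ?thesis
    by (intro exI[of _ \<omega>]) (simp add: \<omega>_def norm_mult r(1))
qed

text \<open>Both groups of bounds come from Toeplitz compressions. One has corner \<gamma>. The
  other uses \<open>k = (1, \<omega>)\<close>: since \<open>\<langle>E k, k\<rangle> / \<langle>k,
  k\<rangle> = \<omega> / 2\<close>, its corner is \<open>\<beta> + \<gamma> \<omega> / 2\<close>,
  of modulus \<open>\<bar>\<beta>\<bar> + \<bar>\<gamma>\<bar> / 2\<close> for aligned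
  \<omega>.\<close>

lemma tri_op_entry_bounds:
  fixes \<alpha> \<beta> \<gamma> :: complex
  defines "M \<equiv> op_norm (coord_space 4) (coord_ip 4) (tri_op \<alpha> \<beta> \<gamma>)"
  shows "cmod \<alpha> \<le> M" and "cmod \<gamma> \<le> M" and "cmod \<gamma> * M \<le> M\<^sup>2 - (cmod \<alpha>)\<^sup>2"
    and "cmod \<beta> + cmod \<gamma> / 2 \<le> M"
    and "(cmod \<beta> + cmod \<gamma> / 2) * M \<le> M\<^sup>2 - (cmod \<alpha>)\<^sup>2"
proof -
  note bound = tri_op_square_bound[where \<alpha> = \<alpha> and \<beta> = \<beta> and \<gamma> = \<gamma>, folded M_def]
  have M: "M \<ge> 0" unfolding M_def by (rule op_norm_tri_op_nonneg)
  \<comment> \<open>Coordinates 0 and 3 see the corner \<gamma>; the output in coordinate 1 is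
    discarded.\<close>
  have "(cmod (\<alpha> * u + \<gamma> * v))\<^sup>2 + (cmod (\<alpha> * v))\<^sup>2 \<le> M\<^sup>2 * ((cmod u)\<^sup>2 + (cmod v)\<^sup>2)" for u v
  proof -
    have "(cmod (\<alpha> * u + \<gamma> * v))\<^sup>2 + (cmod (\<beta> * v))\<^sup>2 + (cmod (\<alpha> * v))\<^sup>2
        \<le> M\<^sup>2 * ((cmod u)\<^sup>2 + (cmod v)\<^sup>2)"
      using bound[where ?x0.0 = u and ?x1.0 = 0 and ?x2.0 = 0 and ?x3.0 = v] by simp
    then show ?thesis
      using zero_le_power2[of "cmod (\<beta> * v)"] by linarith
  qed
  from toeplitz_entry_bounds[OF M this]
  show "cmod \<alpha> \<le> M" "cmod \<gamma> \<le> M" "cmod \<gamma> * M \<le> M\<^sup>2 - (cmod \<alpha>)\<^sup>2" .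
  obtain \<omega> where \<omega>: "cmod \<omega> = 1" "cmod (\<beta> + \<gamma> / 2 * \<omega>) = cmod \<beta> + cmod (\<gamma> / 2)"
    using exists_unimodular_aligned by blast
  define \<delta> where "\<delta> = \<beta> + \<gamma> / 2 * \<omega>"
  have \<delta>: "cmod \<delta> = cmod \<beta> + cmod \<gamma> / 2"
    unfolding \<delta>_def \<omega>(2) by (simp add: norm_divide)
  \<comment> \<open>compression of the matrix to the vectors \<open>(u k, v k)\<close> with \<open>k = (1, \<omega>)\<close>\<close>
  have "(cmod (\<alpha> * u + \<delta> * v))\<^sup>2 + (cmod (\<alpha> * v))\<^sup>2 \<le> M\<^sup>2 * ((cmod u)\<^sup>2 + (cmod v)\<^sup>2)" for u v
  proof -
    \<comment> \<open>\<open>p\<close> and \<open>q\<close> are the first two coordinates of the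
      image of \<open>(u, \<omega> u, v, \<omega> v)\<close>; pairing them with \<open>k\<close>
      gives twice the first row of the compression.\<close>
    define p where "p = \<alpha> * u + \<beta> * v + \<gamma> * (\<omega> * v)"
    define q where "q = \<alpha> * (\<omega> * u) + \<beta> * (\<omega> * v)"
    have \<omega>1: "cnj \<omega> * \<omega> = 1"
      using complex_norm_square[of \<omega>] \<omega>(1) by (simp add: mult.commute)
    have "cnj \<omega> * q = (cnj \<omega> * \<omega>) * (\<alpha> * u + \<beta> * v)"
      by (simp add: q_def algebra_simps)
    then have "2 * (\<alpha> * u + \<delta> * v) = p + cnj \<omega> * q"
      unfolding \<omega>1 by (simp add: p_def \<delta>_def algebra_simps)
    then have "2 * cmod (\<alpha> * u + \<delta> * v) = cmod (p + cnj \<omega> * q)"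
      by (metis norm_mult_numeral1)
    then have "2 * cmod (\<alpha> * u + \<delta> * v) \<le> cmod p + cmod q"
      using norm_triangle_ineq[of p "cnj \<omega> * q"] \<omega>(1)
      by (simp add: norm_mult)
    then have "(2 * cmod (\<alpha> * u + \<delta> * v))\<^sup>2 \<le> (cmod p + cmod q)\<^sup>2"
      by (rule power_mono) simp
    \<comment> \<open>Cauchy-Schwarz; the factor 2 is the squared length of \<open>k\<close> and
      cancels against the doubled input norm below.\<close>
    also have "\<dots> \<le> 2 * ((cmod p)\<^sup>2 + (cmod q)\<^sup>2)"
      using sum_squares_bound[of "cmod p" "cmod q"] by (simp add: power2_sum)
    finally have "2 * (cmod (\<alpha> * u + \<delta> * v))\<^sup>2 \<le> (cmod p)\<^sup>2 + (cmod q)\<^sup>2"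
      by (simp add: power_mult_distrib)
    moreover have "(cmod p)\<^sup>2 + (cmod q)\<^sup>2 + 2 * (cmod (\<alpha> * v))\<^sup>2
        \<le> 2 * (M\<^sup>2 * ((cmod u)\<^sup>2 + (cmod v)\<^sup>2))"
      using bound[where ?x0.0 = u and ?x1.0 = "\<omega> * u" and ?x2.0 = v and ?x3.0 = "\<omega> * v"] \<omega>(1)
      by (simp add: p_def q_def norm_mult algebra_simps)
    ultimately show ?thesis by linarith
  qed
  from toeplitz_entry_bounds[OF M this] \<delta>
  show "cmod \<beta> + cmod \<gamma> / 2 \<le> M" "(cmod \<beta> + cmod \<gamma> / 2) * M \<le> M\<^sup>2 - (cmod \<alpha>)\<^sup>2"
    by simp_all
qed

text \<open>The slack \<open>\<bar>\<gamma>\<bar> M / 2\<close> in the last bound of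
  \<open>tri_op_entry_bounds\<close> covers the growth of the squared diagonal modulus from
  \<open>\<bar>\<alpha>\<bar>^2\<close> to at most
  \<open>(\<bar>\<alpha>\<bar> + \<bar>\<gamma>\<bar> / 4)^2\<close>.\<close>

lemma op_norm_tri_proj_le:
  "op_norm (coord_space 4) (coord_ip 4) (tri_op (\<alpha> + \<gamma> / 4) \<beta> 0)
    \<le> op_norm (coord_space 4) (coord_ip 4) (tri_op \<alpha> \<beta> \<gamma>)"
proof -
  define M where "M = op_norm (coord_space 4) (coord_ip 4) (tri_op \<alpha> \<beta> \<gamma>)"
  define A b n where "A = cmod \<alpha>" and "b = cmod \<beta>" and "n = cmod \<gamma>"
  note bds = tri_op_entry_bounds[where \<alpha> = \<alpha> and \<beta> = \<beta> and \<gamma> = \<gamma>, folded M_def A_def b_def n_def]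
  have nn: "A \<ge> 0" "b \<ge> 0" "n \<ge> 0" by (simp_all add: A_def b_def n_def)
  have M: "M \<ge> 0" using bds(1) nn by linarith
  \<comment> \<open>This yields both \<open>A + n / 4 \<le> M\<close> and
    \<open>A / 2 + n / 16 \<le> M / 2\<close>.\<close>
  have n: "n \<le> 2 * (M - A)"
  proof (cases "M = 0")
    case True
    with bds nn show ?thesis by simp
  next
    case False
    have "n * M \<le> (M - A) * (M + A)"
      using bds(3) by (simp add: power2_eq_square algebra_simps)
    also have "\<dots> \<le> (M - A) * (2 * M)"
      using bds(1) by (intro mult_left_mono) auto
    finally show ?thesis using False M by simp
  qed
  define \<alpha>' where "\<alpha>' = \<alpha> + \<gamma> / 4"
  have \<alpha>': "cmod \<alpha>' \<le> A + n / 4"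
    unfolding \<alpha>'_def A_def n_def by (rule norm_triangle_le) (simp add: norm_divide)
  have "(cmod \<alpha>')\<^sup>2 \<le> (A + n / 4)\<^sup>2"
    using \<alpha>' by (rule power_mono) simp
  also have "\<dots> = A\<^sup>2 + n * (A / 2 + n / 16)"
    by (simp add: power2_eq_square algebra_simps)
  also have "\<dots> \<le> A\<^sup>2 + n * (M / 2)"
    using n nn bds(1) by (intro add_left_mono mult_left_mono) auto
  finally have \<alpha>'2: "b * M \<le> M\<^sup>2 - (cmod \<alpha>')\<^sup>2"
    using bds(5) by (simp add: algebra_simps)
  have \<alpha>'M: "cmod \<alpha>' \<le> M" using \<alpha>' n bds(1) by simp
  have bM: "b \<le> M" using bds(4) nn by linarith
  \<comment> \<open>With \<gamma> removed the matrix splits into two equal Toeplitz blocks, on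
    coordinates 0, 2 and on 1, 3.\<close>
  note toep = toeplitz_norm_bound[OF \<alpha>'M \<alpha>'2[unfolded b_def] bM[unfolded b_def]]
  show ?thesis
    unfolding M_def[symmetric] \<alpha>'_def[symmetric]
  proof (rule op_norm_le[OF M])
    fix f assume f: "f \<in> coord_space 4"
    have "(\<Sum>i<4. (cmod (tri_op \<alpha>' \<beta> 0 f i))\<^sup>2) \<le> M\<^sup>2 * (\<Sum>i<4. (cmod (f i))\<^sup>2)"
      using toep[of "f 0" "f 2"] toep[of "f 1" "f 3"] f
      by (simp add: tri_op_def eval_nat_numeral algebra_simps)
    then have "sqrt (\<Sum>i<4. (cmod (tri_op \<alpha>' \<beta> 0 f i))\<^sup>2)
        \<le> sqrt (M\<^sup>2 * (\<Sum>i<4. (cmod (f i))\<^sup>2))"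
      by (rule real_sqrt_le_mono)
    then show "ip_norm (coord_ip 4) (tri_op \<alpha>' \<beta> 0 f) \<le> M * ip_norm (coord_ip 4) f"
      using M by (simp add: ip_norm_coord_ip real_sqrt_mult)
  qed
qed

section \<open>Verification of the required properties\<close>

lemma op_norm_tri_op_one: "op_norm (coord_space 4) (coord_ip 4) (tri_op 1 0 0) = 1"
proof (rule antisym)
  have "tri_op 1 0 0 f = f" if "f \<in> coord_space 4" for f
    using that by (simp add: tri_op_def fun_eq_iff)
  then show "op_norm (coord_space 4) (coord_ip 4) (tri_op 1 0 0) \<le> 1"
    by (intro op_norm_le) auto
  show "1 \<le> op_norm (coord_space 4) (coord_ip 4) (tri_op 1 0 0)"
    using tri_op_entry_bounds(1)[where \<alpha> = 1 and \<beta> = 0 and \<gamma> = 0] by simp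
qed

lemma subspace_op_smult_coord:
  "module.subspace (op_smult coord_smul) S \<longleftrightarrow> 0 \<in> S \<and> (\<forall>x\<in>S. \<forall>y\<in>S. x + y \<in> S) \<and>
    (\<forall>c. \<forall>x\<in>S. op_smult coord_smul c x \<in> S)"
  by (rule module.subspace_def[OF module_op_smult[OF vector_space_coord_smul]])

lemma operator_algebra_tri_alg: "operator_algebra coord_smul (coord_space 4) (coord_ip 4) tri_alg"
  unfolding operator_algebra_def subspace_op_smult_coord
  by (auto simp: tri_alg_def tri_op_bounded tri_op_add tri_op_smult tri_op_comp tri_op_eq_iff
      simp flip: tri_op_zero)

text \<open>Values of \<open>tri_proj\<close> have no \<open>E\<close> component, and elements
  without one are fixed by it.\<close>

lemma tri_proj_image: "tri_proj ` tri_alg = {tri_op \<alpha> \<beta> 0 |\<alpha> \<beta>. True}"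
proof (intro equalityI subsetI)
  fix T assume "T \<in> tri_proj ` tri_alg"
  then show "T \<in> {tri_op \<alpha> \<beta> 0 |\<alpha> \<beta>. True}"
    unfolding tri_alg_def using tri_proj_tri_op by blast
next
  fix T assume "T \<in> {tri_op \<alpha> \<beta> 0 |\<alpha> \<beta>. True}"
  then obtain \<alpha> \<beta> where T: "T = tri_op \<alpha> \<beta> 0" by blast
  then have "T = tri_proj T" by (simp add: tri_proj_tri_op)
  moreover have "T \<in> tri_alg" using T by (auto simp: tri_alg_def)
  ultimately show "T \<in> tri_proj ` tri_alg" by blast
qed

lemma operator_algebra_tri_proj_image:
  "operator_algebra coord_smul (coord_space 4) (coord_ip 4) (tri_proj ` tri_alg)"
  unfolding operator_algebra_def subspace_op_smult_coord tri_proj_image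
  by (auto simp: tri_op_bounded tri_op_add tri_op_smult tri_op_comp tri_op_eq_iff
      simp flip: tri_op_zero)

lemma contractive_projection_tri_proj:
  "contractive_projection coord_smul (coord_space 4) (coord_ip 4) tri_alg tri_proj"
  unfolding contractive_projection_def
  by (auto simp: tri_alg_def tri_proj_tri_op tri_op_add tri_op_smult tri_op_eq_iff
      op_norm_tri_proj_le add_divide_distrib algebra_simps)

theorem corollary3p6:
  shows "\<exists>(smul :: complex \<Rightarrow> (nat \<Rightarrow> complex) \<Rightarrow> (nat \<Rightarrow> complex)) H ip A e P B.
    complex_hilbert_space smul H ip \<and>
    operator_algebra smul H ip A \<and>
    (\<forall>S\<in>A. \<forall>T\<in>A. S \<circ> T = T \<circ> S) \<and>
    is_identity_of e A \<and> op_norm H ip e = 1 \<and>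
    contractive_projection smul H ip A P \<and>
    B = P ` A \<and> B \<subseteq> A \<and> operator_algebra smul H ip B \<and> e \<in> B \<and>
    (\<exists>a\<in>A. \<exists>b\<in>B. P (b \<circ> a) \<noteq> b \<circ> P a)"
proof (intro exI conjI)
  show "complex_hilbert_space coord_smul (coord_space 4) (coord_ip 4)"
    by (rule complex_hilbert_space_coord)
  show "operator_algebra coord_smul (coord_space 4) (coord_ip 4) tri_alg"
    by (rule operator_algebra_tri_alg)
  show "\<forall>S\<in>tri_alg. \<forall>T\<in>tri_alg. S \<circ> T = T \<circ> S"
    by (auto simp: tri_alg_def tri_op_comp tri_op_eq_iff algebra_simps)
  show "is_identity_of (tri_op 1 0 0) tri_alg"
    by (auto simp: is_identity_of_def tri_alg_def tri_op_comp tri_op_eq_iff)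
  show "op_norm (coord_space 4) (coord_ip 4) (tri_op 1 0 0) = 1"
    by (rule op_norm_tri_op_one)
  show "contractive_projection coord_smul (coord_space 4) (coord_ip 4) tri_alg tri_proj"
    by (rule contractive_projection_tri_proj)
  show "tri_proj ` tri_alg = tri_proj ` tri_alg" ..
  show "tri_proj ` tri_alg \<subseteq> tri_alg"
    unfolding tri_proj_image by (auto simp: tri_alg_def)
  show "operator_algebra coord_smul (coord_space 4) (coord_ip 4) (tri_proj ` tri_alg)"
    by (rule operator_algebra_tri_proj_image)
  show "tri_op 1 0 0 \<in> tri_proj ` tri_alg"
    unfolding tri_proj_image by auto
  \<comment> \<open>Here \<open>b\<close> has corner \<open>I\<close> and \<open>a\<close> has
    corner \<open>E\<close>. Then \<open>b a = 0\<close>, while \<open>P a\<close> is a quarter of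
    the identity, so \<open>b (P a) = b / 4\<close>.\<close>
  have "tri_proj (tri_op 0 1 0 \<circ> tri_op 0 0 1) \<noteq> tri_op 0 1 0 \<circ> tri_proj (tri_op 0 0 1)"
    by (simp add: tri_op_comp tri_proj_tri_op tri_op_eq_iff)
  moreover have "tri_op 0 0 1 \<in> tri_alg" "tri_op 0 1 0 \<in> tri_proj ` tri_alg"
    unfolding tri_proj_image by (auto simp: tri_alg_def)
  ultimately show "\<exists>a\<in>tri_alg. \<exists>b\<in>tri_proj ` tri_alg. tri_proj (b \<circ> a) \<noteq> b \<circ> tri_proj a"
    by blast
qed

end
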